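(* There exists a finite simplicial complex $\widetilde{J}_2$ of dimension $3$ such that: (a) $\dim \mathrm{H}_2(\widetilde{J}_2)=1$; (b) for the filtration $\mathcal{F}$ given by $\emptyset=K_0\subset K_1=\widetilde{J}_2$, there exist a generic bar $b=(1,\infty;1)\in\mathbf{B}_2(\mathcal{F})$ with a harmonic representative $h$, and simplices $\sigma\in\Sigma(b)$, $\tau\in\widetilde{J}_2^{[2]}\setminus\Sigma(b)$, such that $|\langle h,\sigma\rangle|<|\langle h,\tau\rangle|$.
   Context: **Chains.** A finite simplicial complex $K$ is a (possibly empty) set of subsets of a finite set $\{0,\dots,m\}$, closed under passing to subsets. $K^{[p]}$ is the set of $p$-dimensional simplices $[i_0,\dots,i_p]$, $i_0<\cdots<i_p$. $C_p(K)$ is the real vector space with basis $K^{[p]}$, with $\partial_p[i_0,\dots,i_p]=\sum_j(-1)^j[i_0,\dots,\widehat{i_j},\dots,i_p]$ (and $\partial_0=0$). $Z_p(K)=\ker\partial_p$, $B_p(K)=\operatorname{Im}\partial_{p+1}$, $\mathrm{H}_p(K)=Z_p(K)/B_p(K)$ (real, unreduced), and $\phi_p(K):Z_p(K)\to \mathrm{H}_p(K)$ is the quotient map. $C_p(K)$ carries the inner product $\langle\cdot,\cdot\rangle$ for which $K^{[p]}$ is orthonormal; for a subcomplex $L\subset K$ we regard $C_p(L)\subset C_p(K)$. The harmonic homology subspace is $\mathcal{H}_p(K)=Z_p(K)\cap B_p(K)^\perp$. The support of $z=\sum c_\sigma\sigma$ is $\operatorname{supp}(z)=\{\sigma: c_\sigma\ne0\}$.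 **Persistence.** Let $T=\{0,\dots,N\}$ and let $\mathcal{F}=(K_t)_{t\in T}$ be a filtration $K_0\subset\cdots\subset K_N=K$; set $K_{-1}=\emptyset$. For $s\le t$, $i_p^{s,t}:\mathrm{H}_p(K_s)\to \mathrm{H}_p(K_t)$ is induced by inclusion and $\mathrm{H}_p^{s,t}(\mathcal{F})=\operatorname{Im}(i_p^{s,t})$. For $s\le t$ in $T$ let $M_p^{s,t}(\mathcal{F})=(i_p^{s,t})^{-1}(\mathrm{H}_p^{s-1,t}(\mathcal{F}))\subset \mathrm{H}_p(K_s)$. For $s<t$ in $T$ let $P_p^{s,t}(\mathcal{F})=M_p^{s,t}(\mathcal{F})/M_p^{s,t-1}(\mathcal{F})$, and let $P_p^{s,\infty}(\mathcal{F})=\mathrm{H}_p(K_s)/M_p^{s,N}(\mathcal{F})$. Put $\mu_p^{s,t}(\mathcal{F})=\dim P_p^{s,t}(\mathcal{F})$ for $s\in T$, $t\in T\cup\{\infty\}$, $s<t$. The barcode is $\mathbf{B}_p(\mathcal{F})=\{(s,t;\mu_p^{s,t}(\mathcal{F})):\mu_p^{s,t}(\mathcal{F})>0\}$; its elements are called bars. A bar is simple if $\mu_p^{s,t}(\mathcal{F})=1$. It is generic if it is simple and $\mu_p^{s,t'}(\mathcal{F})=0$ for every $t'\in T\cup\{\infty\}$ with $t'>s$, $t'\ne t$. **Harmonic representatives.** For $s\le t$, let $\mathfrak{i}_p^{s,t}:\mathcal{H}_p(K_s)\to\mathcal{H}_p(K_t)$ be the restriction to $\mathcal{H}_p(K_s)$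 of orthogonal projection onto $B_p(K_t)^\perp$, and $\mathcal{H}_p^{s,t}(\mathcal{F})=\operatorname{Im}\mathfrak{i}_p^{s,t}$. Let $\mathcal{M}_p^{s,t}(\mathcal{F})=(\mathfrak{i}_p^{s,t})^{-1}(\mathcal{H}_p^{s-1,t}(\mathcal{F}))$ for $s\le t$, $\mathcal{P}_p^{s,t}(\mathcal{F})=\mathcal{M}_p^{s,t}(\mathcal{F})\cap\mathcal{M}_p^{s,t-1}(\mathcal{F})^\perp$ for $s<t\le N$, and $\mathcal{P}_p^{s,\infty}(\mathcal{F})=\mathcal{H}_p(K_s)\cap\mathcal{M}_p^{s,N}(\mathcal{F})^\perp$. A harmonic representative of a simple bar $b=(s,t;1)$ is any nonzero element of $\mathcal{P}_p^{s,t}(\mathcal{F})$. **Essential simplices.** Let $\widetilde{M}_p^{s,t}(\mathcal{F})=\phi_p(K_s)^{-1}(M_p^{s,t}(\mathcal{F}))\subset Z_p(K_s)$. For a simple bar $b=(s,t;1)$, $\mathrm{Rep}(b)=\widetilde{M}_p^{s,t}(\mathcal{F})\setminus\widetilde{M}_p^{s,t-1}(\mathcal{F})$ if $t\neq\infty$, and $\mathrm{Rep}(b)=Z_p(K_s)\setminus\widetilde{M}_p^{s,N}(\mathcal{F})$ if $t=\infty$. The set of essential simplices of $b$ is $\Sigma(b)=\bigcap_{z\in\mathrm{Rep}(b)}\operatorname{supp}(z)$. *)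

theory Defs
  imports
    "HOL-Analysis.Finite_Function_Topology"
    "HOL-Library.Extended_Nat"
    "HOL-Algebra.AbelCoset"
    "Jordan_Normal_Form.VS_Connect"
begin

section \<open>Quotients of real vector spaces\<close>

text \<open>
  Vector spaces are \<open>module\<close> records over the ring record \<open>class_ring\<close> of the reals.
  The \<open>mult\<close> and \<open>one\<close> fields of such a record have no meaning.  Scalar multiplication on
  the cosets follows the pattern of \<open>rcoset_mult\<close>:
  \<open>r (W + v) = W + r v\<close>, also for \<open>r = 0\<close>.
\<close>

definition quotient_space :: "(real, 'v) module \<Rightarrow> 'v set \<Rightarrow> (real, 'v set) module" where
  "quotient_space V W =
    \<lparr>carrier = a_rcosets\<^bsub>V\<^esub> W, mult = undefined, one = undefined,
     zero = W, add = (\<lambda>A B. A <+>\<^bsub>V\<^esub> B),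
     smult = (\<lambda>r A. \<Union>v\<in>A. W +>\<^bsub>V\<^esub> (r \<odot>\<^bsub>V\<^esub> v))\<rparr>"

abbreviation real_dim :: "(real, 'v) module \<Rightarrow> nat" where
  "real_dim V \<equiv> vectorspace.dim (class_ring :: real ring) V"


section \<open>Simplicial complexes and chains\<close>

text \<open>
  Downward closure is taken literally, so a nonempty complex contains the empty set.  It is
  never a \<open>p\<close>-simplex, since \<open>p\<close>-simplices have \<open>p + 1\<close> elements.
\<close>

type_synonym simplicial_complex = "nat set set"

definition finite_complex :: "simplicial_complex \<Rightarrow> bool" where
  "finite_complex K \<longleftrightarrow> (\<exists>m. K \<subseteq> Pow {0..m}) \<and> (\<forall>\<sigma>\<in>K. \<forall>\<rho>. \<rho> \<subseteq> \<sigma> \<longrightarrow> \<rho> \<in> K)"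

definition simplices :: "nat \<Rightarrow> simplicial_complex \<Rightarrow> nat set set" where
  "simplices p K = {\<sigma> \<in> K. finite \<sigma> \<and> card \<sigma> = Suc p}"

definition complex_dim :: "simplicial_complex \<Rightarrow> int" where
  "complex_dim K = (if K = {} then -1 else Max ((\<lambda>\<sigma>. int (card \<sigma>) - 1) ` K))"

type_synonym chain = "nat set \<Rightarrow>\<^sub>0 real"

definition chain_space :: "nat \<Rightarrow> simplicial_complex \<Rightarrow> (real, chain) module" where
  "chain_space p K =
    \<lparr>carrier = {c. Poly_Mapping.keys c \<subseteq> simplices p K}, mult = undefined, one = undefined,
     zero = 0, add = (+), smult = (*\<^sub>R)\<rparr>"

abbreviation supp :: "chain \<Rightarrow> nat set set" where
  "supp c \<equiv> Poly_Mapping.keys c"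

text \<open>The simplex \<open>\<sigma>\<close> as an element of the chosen basis of the chain space.\<close>

definition basis_chain :: "nat set \<Rightarrow> chain" where
  "basis_chain \<sigma> = Poly_Mapping.single \<sigma> 1"

definition chain_inner :: "chain \<Rightarrow> chain \<Rightarrow> real" where
  "chain_inner c d = (\<Sum>\<sigma>\<in>supp c. Poly_Mapping.lookup c \<sigma> * Poly_Mapping.lookup d \<sigma>)"

definition orth_complement :: "chain set \<Rightarrow> chain set" where
  "orth_complement U = {c. \<forall>u\<in>U. chain_inner c u = 0}"

definition simplex_boundary :: "nat set \<Rightarrow> chain" where
  "simplex_boundary \<sigma> =
    (\<Sum>j<card \<sigma>. ((-1) ^ j) *\<^sub>R basis_chain (\<sigma> - {sorted_list_of_set \<sigma> ! j}))"

text \<open>The case \<open>p = 0\<close> makes the theory unreduced.\<close>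

definition boundary :: "nat \<Rightarrow> chain \<Rightarrow> chain" where
  "boundary p c =
    (if p = 0 then 0 else \<Sum>\<sigma>\<in>supp c. Poly_Mapping.lookup c \<sigma> *\<^sub>R simplex_boundary \<sigma>)"


section \<open>Homology and harmonic homology\<close>

definition cycles :: "nat \<Rightarrow> simplicial_complex \<Rightarrow> chain set" where
  "cycles p K = {c \<in> carrier (chain_space p K). boundary p c = 0}"

definition boundaries :: "nat \<Rightarrow> simplicial_complex \<Rightarrow> chain set" where
  "boundaries p K = boundary (Suc p) ` carrier (chain_space (Suc p) K)"

definition cycle_space :: "nat \<Rightarrow> simplicial_complex \<Rightarrow> (real, chain) module" where
  "cycle_space p K = (chain_space p K)\<lparr>carrier := cycles p K\<rparr>"

definition homology :: "nat \<Rightarrow> simplicial_complex \<Rightarrow> (real, chain set) module" where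
  "homology p K = quotient_space (cycle_space p K) (boundaries p K)"

definition homology_class :: "nat \<Rightarrow> simplicial_complex \<Rightarrow> chain \<Rightarrow> chain set" where
  "homology_class p K z = boundaries p K +>\<^bsub>cycle_space p K\<^esub> z"

text \<open>
  The map into the homology of \<open>K\<close> induced by the inclusion of a subcomplex \<open>L\<close>:
  all cycles \<open>z\<close> in a class of \<open>L\<close> have the same class in \<open>K\<close>, which is the union below.
\<close>

definition induced_map :: "nat \<Rightarrow> simplicial_complex \<Rightarrow> chain set \<Rightarrow> chain set" where
  "induced_map p K A = (\<Union>z\<in>A. homology_class p K z)"

definition harmonic :: "nat \<Rightarrow> simplicial_complex \<Rightarrow> chain set" where
  "harmonic p K = cycles p K \<inter> orth_complement (boundaries p K)"

text \<open>Orthogonal projection onto the orthogonal complement of the space of boundaries of \<open>K\<close>.\<close>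

definition harmonic_proj :: "nat \<Rightarrow> simplicial_complex \<Rightarrow> chain \<Rightarrow> chain" where
  "harmonic_proj p K z =
    (THE u. u \<in> orth_complement (boundaries p K) \<and> z - u \<in> boundaries p K)"


section \<open>Persistence\<close>

text \<open>A filtration \<open>K\<^sub>0 \<subseteq> \<dots> \<subseteq> K\<^sub>N\<close> is the nonempty list of its stages.\<close>

type_synonym filtration = "simplicial_complex list"

definition is_filtration :: "filtration \<Rightarrow> bool" where
  "is_filtration F \<longleftrightarrow> F \<noteq> [] \<and> (\<forall>K\<in>set F. finite_complex K) \<and> sorted_wrt (\<subseteq>) F"

definition last_time :: "filtration \<Rightarrow> nat" where
  "last_time F = length F - 1"

text \<open>The stage \<open>K\<^bsub>s-1\<^esub>\<close>, with \<open>K\<^bsub>-1\<^esub>\<close> empty.\<close>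

definition prev_stage :: "filtration \<Rightarrow> nat \<Rightarrow> simplicial_complex" where
  "prev_stage F s = (if s = 0 then {} else F ! (s - 1))"

text \<open>\<open>pers_M p F s t\<close> is meant for \<open>s \<le> t\<close>, so that \<open>pers_M p F s (t - 1)\<close> makes sense for \<open>s < t\<close>.\<close>

definition pers_M :: "nat \<Rightarrow> filtration \<Rightarrow> nat \<Rightarrow> nat \<Rightarrow> chain set set" where
  "pers_M p F s t =
    {x \<in> carrier (homology p (F ! s)).
       induced_map p (F ! t) x \<in>
         induced_map p (F ! t) ` carrier (homology p (prev_stage F s))}"

definition pers_P :: "nat \<Rightarrow> filtration \<Rightarrow> nat \<Rightarrow> enat \<Rightarrow> (real, chain set set) module" where
  "pers_P p F s d = (case d of
     enat t \<Rightarrow> quotient_space ((homology p (F ! s))\<lparr>carrier := pers_M p F s t\<rparr>)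
                             (pers_M p F s (t - 1))
   | \<infinity> \<Rightarrow> quotient_space (homology p (F ! s)) (pers_M p F s (last_time F)))"

definition pers_mult :: "nat \<Rightarrow> filtration \<Rightarrow> nat \<Rightarrow> enat \<Rightarrow> nat" where
  "pers_mult p F s d = real_dim (pers_P p F s d)"

definition birth_times :: "filtration \<Rightarrow> nat set" where
  "birth_times F = {0..last_time F}"

definition death_times :: "filtration \<Rightarrow> enat set" where
  "death_times F = insert \<infinity> (enat ` {0..last_time F})"

type_synonym bar = "nat \<times> enat \<times> nat"

definition barcode :: "nat \<Rightarrow> filtration \<Rightarrow> bar set" where
  "barcode p F = {(s, d, m). s \<in> birth_times F \<and> d \<in> death_times F \<and> enat s < d \<and>
     m = pers_mult p F s d \<and> m > 0}"

fun simple_bar :: "nat \<Rightarrow> filtration \<Rightarrow> bar \<Rightarrow> bool" where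
  "simple_bar p F (s, d, m) \<longleftrightarrow> (s, d, m) \<in> barcode p F \<and> pers_mult p F s d = 1"

fun generic_bar :: "nat \<Rightarrow> filtration \<Rightarrow> bar \<Rightarrow> bool" where
  "generic_bar p F (s, d, m) \<longleftrightarrow> simple_bar p F (s, d, m) \<and>
     (\<forall>d'\<in>death_times F. enat s < d' \<and> d' \<noteq> d \<longrightarrow> pers_mult p F s d' = 0)"


section \<open>Harmonic representatives\<close>

definition harmonic_M :: "nat \<Rightarrow> filtration \<Rightarrow> nat \<Rightarrow> nat \<Rightarrow> chain set" where
  "harmonic_M p F s t =
    {z \<in> harmonic p (F ! s).
       harmonic_proj p (F ! t) z \<in> harmonic_proj p (F ! t) ` harmonic p (prev_stage F s)}"

definition harmonic_P :: "nat \<Rightarrow> filtration \<Rightarrow> nat \<Rightarrow> enat \<Rightarrow> chain set" where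
  "harmonic_P p F s d = (case d of
     enat t \<Rightarrow> harmonic_M p F s t \<inter> orth_complement (harmonic_M p F s (t - 1))
   | \<infinity> \<Rightarrow> harmonic p (F ! s) \<inter> orth_complement (harmonic_M p F s (last_time F)))"

fun harmonic_rep :: "nat \<Rightarrow> filtration \<Rightarrow> bar \<Rightarrow> chain \<Rightarrow> bool" where
  "harmonic_rep p F (s, d, m) h \<longleftrightarrow>
     simple_bar p F (s, d, m) \<and> h \<in> harmonic_P p F s d \<and> h \<noteq> 0"


section \<open>Essential simplices\<close>

definition cycles_M :: "nat \<Rightarrow> filtration \<Rightarrow> nat \<Rightarrow> nat \<Rightarrow> chain set" where
  "cycles_M p F s t = {z \<in> cycles p (F ! s). homology_class p (F ! s) z \<in> pers_M p F s t}"

fun bar_reps :: "nat \<Rightarrow> filtration \<Rightarrow> bar \<Rightarrow> chain set" where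
  "bar_reps p F (s, d, m) = (case d of
     enat t \<Rightarrow> cycles_M p F s t - cycles_M p F s (t - 1)
   | \<infinity> \<Rightarrow> cycles p (F ! s) - cycles_M p F s (last_time F))"

definition essential_simplices :: "nat \<Rightarrow> filtration \<Rightarrow> bar \<Rightarrow> nat set set" where
  "essential_simplices p F b = (\<Inter>z\<in>bar_reps p F b. supp z)"

end

theory Submission
  imports Defs
begin

text \<open>
  Take the six-vertex triangulation of the real projective plane, whose edges are all pairs of
  vertices, and let \<open>\<tau> = {0,1,2}\<close> be a triangle outside it.  The boundary of \<open>\<tau>\<close> is the nontrivial
  loop, so the ten triangles of the projective plane carry a chain with coefficients \<open>\<plusminus>1\<close> whose boundary is twice
  that of \<open>\<tau>\<close>.  Adding \<open>\<tau>\<close> thus creates one class of 2-cycles, with coefficient 2 on \<open>\<tau>\<close>.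
  Erecting a tetrahedron on \<open>\<tau>\<close> with a new apex 6 lets a cycle avoid \<open>\<tau>\<close>, so \<open>\<tau>\<close> is not
  essential, while the ten triangles remain essential.  The harmonic cycle spreads the weight 2 over
  \<open>\<tau>\<close> and the three other faces of the tetrahedron in the ratio 3 to 1, so that it has absolute
  value 3/2 on \<open>\<tau>\<close> against 1 on the ten triangles; it is scaled by 2 below.
\<close>

section \<open>Quotient spaces\<close>

text \<open>Negatives stay in \<open>W\<close> because the negative of \<open>w\<close> is its
  multiple by -1. This makes the coset calculus of abelian groups available for subspaces.\<close>

lemma subspace_abelian_subgroup:
  assumes "subspace K W V"
  shows "abelian_subgroup W V"
proof -
  interpret vectorspace K V
    using assms by (simp add: subspace_def)
  have W: "LinearCombinations.submodule K W V"
    using assms by (simp add: subspace_def)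
  have inv: "\<ominus>\<^bsub>V\<^esub> w \<in> W" if "w \<in> W" for w
  proof -
    have w: "w \<in> carrier V"
      using W that by (auto simp: LinearCombinations.submodule_def)
    have "(\<ominus>\<^bsub>K\<^esub> \<one>\<^bsub>K\<^esub>) \<odot>\<^bsub>V\<^esub> w \<in> W"
      using W that unfolding LinearCombinations.submodule_def by simp
    then show ?thesis
      using w by (simp add: smult_l_minus)
  qed
  have "subgroup W (add_monoid V)"
    using W inv unfolding LinearCombinations.submodule_def
    by (intro add.subgroupI) auto
  then show ?thesis
    by (intro abelian_subgroupI3 additive_subgroupI abelian_group_axioms)
qed

context
  fixes V :: "(real, 'v) module" (structure) and W :: "'v set"
  assumes sub: "subspace (class_ring :: real ring) W V"
begin

interpretation vectorspace "class_ring :: real ring" V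
  using sub by (simp add: subspace_def)

interpretation abelian_subgroup W V
  using sub by (rule subspace_abelian_subgroup)

lemma subspace_smult_closed: "w \<in> W \<Longrightarrow> r \<odot> w \<in> W"
  using sub by (simp add: subspace_def LinearCombinations.submodule_def)

lemma coset_eq:
  assumes "x \<in> carrier V" "y \<in> W +> x"
  shows "W +> y = W +> x"
  using a_repr_independence[OF assms(2,1) a_subgroup] by simp

lemma quotient_space_carrierE:
  assumes "A \<in> carrier (quotient_space V W)"
  obtains x where "x \<in> carrier V" "A = W +> x"
  using assms by (auto simp: quotient_space_def A_RCOSETS_def')

lemma quotient_space_coset_in_carrier:
  "x \<in> carrier V \<Longrightarrow> W +> x \<in> carrier (quotient_space V W)"
  by (auto simp: quotient_space_def A_RCOSETS_def')

lemma quotient_space_zero: "\<zero>\<^bsub>quotient_space V W\<^esub> = W"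
  by (simp add: quotient_space_def)

lemma quotient_space_add:
  assumes "x \<in> carrier V" "y \<in> carrier V"
  shows "(W +> x) \<oplus>\<^bsub>quotient_space V W\<^esub> (W +> y) = W +> (x \<oplus> y)"
  using a_rcos_sum[OF assms] by (simp add: quotient_space_def)

text \<open>The scalar product is a union over all representatives of the coset. Two of them differ
  by an element of \<open>W\<close>, whose multiple by \<open>r\<close> is again in
  \<open>W\<close>, so all members of the union agree; since a coset is nonempty, the union
  collapses to that one coset.\<close>

lemma quotient_space_smult:
  assumes x: "x \<in> carrier V"
  shows "r \<odot>\<^bsub>quotient_space V W\<^esub> (W +> x) = W +> (r \<odot> x)"
proof -
  have eq: "W +> (r \<odot> u) = W +> (r \<odot> x)" if u: "u \<in> W +> x" for u
  proof -
    obtain w where w: "w \<in> W" "u = w \<oplus> x"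
      using u by (auto simp: a_r_coset_def')
    then have "w \<in> carrier V"
      using a_subset by auto
    then have "r \<odot> u = r \<odot> w \<oplus> r \<odot> x"
      using w x by (simp add: smult_r_distr)
    moreover have "r \<odot> w \<oplus> r \<odot> x \<in> W +> (r \<odot> x)"
      using w x by (intro a_rcosI subspace_smult_closed a_subset) simp_all
    ultimately show ?thesis
      using x by (intro coset_eq) simp_all
  qed
  have ne: "W +> x \<noteq> {}"
    using a_rcosI[OF zero_closed a_subset x] by blast
  have "r \<odot>\<^bsub>quotient_space V W\<^esub> (W +> x) = (\<Union>u\<in>W +> x. W +> (r \<odot> u))"
    by (simp add: quotient_space_def)
  also have "\<dots> = (\<Union>u\<in>W +> x. W +> (r \<odot> x))"
    by (rule SUP_cong[OF refl eq])
  finally show ?thesis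
    using ne by simp
qed

lemma vectorspace_quotient_space: "vectorspace (class_ring :: real ring) (quotient_space V W)"
proof -
  let ?Q = "quotient_space V W"
  note q = quotient_space_add quotient_space_smult quotient_space_coset_in_carrier
  have zero: "\<zero>\<^bsub>?Q\<^esub> = W +> \<zero>"
    by (simp add: quotient_space_def a_subset)
  have ag: "abelian_group ?Q"
  proof (rule abelian_groupI)
    fix A assume "A \<in> carrier ?Q"
    then obtain x where x: "x \<in> carrier V" "A = W +> x"
      by (rule quotient_space_carrierE)
    then have "(W +> (\<ominus> x)) \<oplus>\<^bsub>?Q\<^esub> A = \<zero>\<^bsub>?Q\<^esub>"
      by (simp add: q zero l_neg)
    then show "\<exists>B\<in>carrier ?Q. B \<oplus>\<^bsub>?Q\<^esub> A = \<zero>\<^bsub>?Q\<^esub>"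
      using x q(3) by blast
  qed (auto elim!: quotient_space_carrierE simp: q zero a_ac)
  have "module (class_ring :: real ring) ?Q"
  proof (rule moduleI)
    fix r t :: real and A B
    assume A: "A \<in> carrier ?Q"
    then obtain x where x: "x \<in> carrier V" "A = W +> x"
      by (rule quotient_space_carrierE)
    show "r \<odot>\<^bsub>?Q\<^esub> A \<in> carrier ?Q"
      using x by (simp add: q)
    show "(r \<oplus>\<^bsub>class_ring\<^esub> t) \<odot>\<^bsub>?Q\<^esub> A = r \<odot>\<^bsub>?Q\<^esub> A \<oplus>\<^bsub>?Q\<^esub> t \<odot>\<^bsub>?Q\<^esub> A"
      using x smult_l_distr[of r t x] by (simp add: q)
    show "(r \<otimes>\<^bsub>class_ring\<^esub> t) \<odot>\<^bsub>?Q\<^esub> A = r \<odot>\<^bsub>?Q\<^esub> (t \<odot>\<^bsub>?Q\<^esub> A)"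
      using x smult_assoc1[of r t x] by (simp add: q)
    show "\<one>\<^bsub>class_ring\<^esub> \<odot>\<^bsub>?Q\<^esub> A = A"
      using x smult_one[of x] by (simp add: q)
    assume "B \<in> carrier ?Q"
    then obtain y where y: "y \<in> carrier V" "B = W +> y"
      by (rule quotient_space_carrierE)
    show "r \<odot>\<^bsub>?Q\<^esub> (A \<oplus>\<^bsub>?Q\<^esub> B) = r \<odot>\<^bsub>?Q\<^esub> A \<oplus>\<^bsub>?Q\<^esub> r \<odot>\<^bsub>?Q\<^esub> B"
      using x y smult_r_distr[of r x y] by (simp add: q)
  qed (rule class_cring.cring_axioms, rule ag)
  then show ?thesis
    by (simp add: vectorspace_def class_field)
qed

text \<open>The coset of \<open>v\<close> is nonzero as \<open>v\<close> is outside
  \<open>W\<close>, and it spans because every \<open>x\<close> is congruent to a multiple of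
  \<open>v\<close>. The criterion serves twice: for cycles modulo boundaries and for homology modulo
  its zero subspace.\<close>

lemma real_dim_quotient_space_eq_1:
  assumes v: "v \<in> carrier V" "v \<notin> W"
    and gen: "\<And>x. x \<in> carrier V \<Longrightarrow> \<exists>r. \<exists>w\<in>W. x = w \<oplus> r \<odot> v"
  shows "real_dim (quotient_space V W) = 1"
proof -
  let ?Q = "quotient_space V W" and ?q = "W +> v"
  have "v \<in> ?q"
    using a_rcosI[OF zero_closed a_subset v(1)] v(1) by simp
  then have "?q \<noteq> W"
    using v(2) by blast
  then have nz: "?q \<noteq> \<zero>\<^bsub>?Q\<^esub>"
    unfolding quotient_space_zero .
  interpret Q: vectorspace "class_ring :: real ring" ?Q
    by (rule vectorspace_quotient_space)
  have q: "{?q} \<subseteq> carrier ?Q"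
    using v quotient_space_coset_in_carrier by simp
  note span = Q.span_is_submodule[OF q] Q.in_own_span[OF q]
  have "A \<in> Q.span {?q}" if A: "A \<in> carrier ?Q" for A
  proof -
    obtain x where x: "x \<in> carrier V" "A = W +> x"
      using A by (rule quotient_space_carrierE)
    obtain r w where w: "w \<in> W" "x = w \<oplus> r \<odot> v"
      using gen[OF x(1)] by blast
    have "w \<oplus> r \<odot> v \<in> W +> (r \<odot> v)"
      using w v by (intro a_rcosI a_subset) simp_all
    then have "A = W +> (r \<odot> v)"
      unfolding x w using v by (intro coset_eq) simp_all
    also have "\<dots> = r \<odot>\<^bsub>?Q\<^esub> ?q"
      using v by (simp add: quotient_space_smult)
    finally show ?thesis
      using LinearCombinations.submodule.smult_closed[OF span(1), of r ?q] span(2) by simp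
  qed
  then have gen_q: "Q.span {?q} = carrier ?Q"
    using LinearCombinations.submodule.subset[OF span(1)] by blast
  show ?thesis
    by (rule Q.dim1I[OF gen_q nz quotient_space_coset_in_carrier[OF v(1)]])
qed

end

section \<open>Chains and homology\<close>

lemma lookup_scaleR [simp]:
  "Poly_Mapping.lookup (r *\<^sub>R c) k = r *\<^sub>R Poly_Mapping.lookup (c :: _ \<Rightarrow>\<^sub>0 'b::real_vector) k"
proof -
  have "finite {i. r *\<^sub>R Poly_Mapping.lookup c i \<noteq> 0}"
    by (rule finite_subset[OF _ finite_lookup[of c]]) auto
  then show ?thesis
    by (simp add: scaleR_poly_mapping_def)
qed

lemma keys_scaleR_subset: "Poly_Mapping.keys (r *\<^sub>R c) \<subseteq> Poly_Mapping.keys (c :: _ \<Rightarrow>\<^sub>0 'b::real_vector)"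
  by (auto simp: in_keys_iff)

text \<open>Terms outside the support vanish. Chains with different supports can thus be summed over
  a common index set, which gives linearity.\<close>

lemma boundary_eq_sum:
  assumes "finite S" "supp c \<subseteq> S" "p \<noteq> 0"
  shows "boundary p c = (\<Sum>\<sigma>\<in>S. Poly_Mapping.lookup c \<sigma> *\<^sub>R simplex_boundary \<sigma>)"
  unfolding boundary_def using assms by (auto intro!: sum.mono_neutral_left simp: in_keys_iff)

lemma boundary_add: "boundary p (c + d) = boundary p c + boundary p d"
proof (cases "p = 0")
  case False
  have "finite (supp c \<union> supp d)" "supp (c + d) \<subseteq> supp c \<union> supp d"
    using keys_add[of c d] by auto
  then show ?thesis
    using False by (simp add: boundary_eq_sum[where S = "supp c \<union> supp d"] lookup_add
        scaleR_add_left sum.distrib)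
qed (simp add: boundary_def)

lemma boundary_scaleR: "boundary p (r *\<^sub>R c) = r *\<^sub>R boundary p c"
proof (cases "p = 0")
  case False
  then show ?thesis
    using keys_scaleR_subset[of r c]
    by (simp add: boundary_eq_sum[where S = "supp c"] scaleR_sum_right)
qed (simp add: boundary_def)

lemma boundary_zero [simp]: "boundary p 0 = 0"
  by (simp add: boundary_def)

lemma cycles_add: "c \<in> cycles p K \<Longrightarrow> d \<in> cycles p K \<Longrightarrow> c + d \<in> cycles p K"
  using keys_add[of c d] by (auto simp: cycles_def chain_space_def boundary_add)

lemma cycles_scaleR: "c \<in> cycles p K \<Longrightarrow> r *\<^sub>R c \<in> cycles p K"
  using keys_scaleR_subset[of r c] by (auto simp: cycles_def chain_space_def boundary_scaleR)

lemma cycles_zero [simp]: "0 \<in> cycles p K"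
  by (simp add: cycles_def chain_space_def)

lemma boundariesE:
  assumes "c \<in> boundaries p K"
  obtains x where "supp x \<subseteq> simplices (Suc p) K" "c = boundary (Suc p) x"
  using assms by (auto simp: boundaries_def chain_space_def)

lemma boundariesI: "supp x \<subseteq> simplices (Suc p) K \<Longrightarrow> boundary (Suc p) x \<in> boundaries p K"
  by (simp add: boundaries_def chain_space_def)

lemma boundaries_add:
  assumes "c \<in> boundaries p K" "d \<in> boundaries p K"
  shows "c + d \<in> boundaries p K"
proof -
  obtain x y where x: "supp x \<subseteq> simplices (Suc p) K" "c = boundary (Suc p) x"
    and y: "supp y \<subseteq> simplices (Suc p) K" "d = boundary (Suc p) y"
    using assms by (elim boundariesE)
  then have "supp (x + y) \<subseteq> simplices (Suc p) K"
    using keys_add[of x y] by blast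
  then show ?thesis
    using boundariesI[of "x + y" p K] x y by (simp add: boundary_add)
qed

lemma boundaries_scaleR:
  assumes "c \<in> boundaries p K"
  shows "r *\<^sub>R c \<in> boundaries p K"
proof -
  obtain x where x: "supp x \<subseteq> simplices (Suc p) K" "c = boundary (Suc p) x"
    using assms by (rule boundariesE)
  then have "supp (r *\<^sub>R x) \<subseteq> simplices (Suc p) K"
    using keys_scaleR_subset[of r x] by blast
  then show ?thesis
    using boundariesI[of "r *\<^sub>R x" p K] x by (simp add: boundary_scaleR)
qed

lemma boundaries_zero [simp]: "0 \<in> boundaries p K"
  by (auto simp: boundaries_def chain_space_def intro!: image_eqI[where x = 0])

lemma cycle_space_simps [simp]:
  "carrier (cycle_space p K) = cycles p K" "zero (cycle_space p K) = 0"
  "add (cycle_space p K) = (+)" "smult (cycle_space p K) = (*\<^sub>R)"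
  by (simp_all add: cycle_space_def chain_space_def)

lemma vectorspace_cycle_space: "vectorspace (class_ring :: real ring) (cycle_space p K)"
proof -
  have "\<exists>d\<in>cycles p K. d + c = 0" if "c \<in> cycles p K" for c
    using cycles_scaleR[OF that, of "-1"] by (intro bexI[of _ "-c"]) auto
  then have "abelian_group (cycle_space p K)"
    by (intro abelian_groupI) (auto simp: cycles_add add_ac)
  then have "module (class_ring :: real ring) (cycle_space p K)"
    by (intro moduleI)
      (auto simp: cycles_scaleR algebra_simps intro: class_cring.cring_axioms)
  then show ?thesis
    by (simp add: vectorspace_def class_field)
qed

lemma supp_subset_simplices: "c \<in> cycles p K \<Longrightarrow> supp c \<subseteq> simplices p K"
  by (simp add: cycles_def chain_space_def)

section \<open>Inner product and harmonic projection\<close>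

lemma chain_inner_eq_sum:
  assumes "finite S" "supp c \<subseteq> S"
  shows "chain_inner c d = (\<Sum>\<sigma>\<in>S. Poly_Mapping.lookup c \<sigma> * Poly_Mapping.lookup d \<sigma>)"
  unfolding chain_inner_def using assms by (auto intro!: sum.mono_neutral_left simp: in_keys_iff)

lemma chain_inner_diff_left: "chain_inner (c - c') d = chain_inner c d - chain_inner c' d"
proof -
  have "finite (supp c \<union> supp c')" "supp (c - c') \<subseteq> supp c \<union> supp c'"
    by (auto simp: in_keys_iff lookup_minus)
  then show ?thesis
    by (simp add: chain_inner_eq_sum[where S = "supp c \<union> supp c'"] lookup_minus
        left_diff_distrib sum_subtractf)
qed

lemma chain_inner_basis_chain: "chain_inner c (basis_chain \<sigma>) = Poly_Mapping.lookup c \<sigma>"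
proof -
  have "chain_inner c (basis_chain \<sigma>)
      = (\<Sum>\<rho>\<in>insert \<sigma> (supp c). Poly_Mapping.lookup c \<rho> * Poly_Mapping.lookup (basis_chain \<sigma>) \<rho>)"
    by (intro chain_inner_eq_sum) auto
  also have "\<dots> = (\<Sum>\<rho>\<in>insert \<sigma> (supp c). if \<rho> = \<sigma> then Poly_Mapping.lookup c \<rho> else 0)"
    by (intro sum.cong) (auto simp: basis_chain_def lookup_single when_def)
  finally show ?thesis
    by simp
qed

lemma chain_inner_self_eq_0: "chain_inner c c = 0 \<longleftrightarrow> c = 0"
  by (auto simp: chain_inner_def sum_nonneg_eq_0_iff in_keys_iff intro!: poly_mapping_eqI)

text \<open>For any other candidate \<open>u\<close>, the difference \<open>z - u\<close> is both a
  boundary and orthogonal to all boundaries, hence orthogonal to itself and zero.\<close>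

lemma harmonic_proj_harmonic:
  assumes "z \<in> harmonic p K"
  shows "harmonic_proj p K z = z"
  unfolding harmonic_proj_def
proof (rule the_equality)
  show "z \<in> orth_complement (boundaries p K) \<and> z - z \<in> boundaries p K"
    using assms by (simp add: harmonic_def)
  fix u assume u: "u \<in> orth_complement (boundaries p K) \<and> z - u \<in> boundaries p K"
  then have "chain_inner (z - u) (z - u) = 0"
    using assms by (simp add: chain_inner_diff_left harmonic_def orth_complement_def)
  then show "u = z"
    by (simp add: chain_inner_self_eq_0)
qed

lemma zero_in_harmonic [simp]: "0 \<in> harmonic p K"
  by (simp add: harmonic_def orth_complement_def chain_inner_def)

section \<open>Homology of a complex whose boundaries are cycles\<close>

context
  fixes p :: nat and K :: simplicial_complex
  assumes boundaries_subset: "boundaries p K \<subseteq> cycles p K"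
begin

interpretation Z: vectorspace "class_ring :: real ring" "cycle_space p K"
  by (rule vectorspace_cycle_space)

lemma subspace_boundaries: "subspace (class_ring :: real ring) (boundaries p K) (cycle_space p K)"
  unfolding subspace_def LinearCombinations.submodule_def
  using boundaries_subset Z.vectorspace_axioms Z.module.module_axioms
  by (auto simp: boundaries_add boundaries_scaleR)

interpretation abelian_subgroup "boundaries p K" "cycle_space p K"
  by (rule subspace_abelian_subgroup[OF subspace_boundaries])

lemma vectorspace_homology: "vectorspace (class_ring :: real ring) (homology p K)"
  unfolding homology_def by (rule vectorspace_quotient_space[OF subspace_boundaries])

interpretation H: vectorspace "class_ring :: real ring" "homology p K"
  by (rule vectorspace_homology)

lemma homology_zero: "\<zero>\<^bsub>homology p K\<^esub> = boundaries p K"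
  by (simp add: homology_def quotient_space_def)

lemma homology_carrier: "carrier (homology p K) = homology_class p K ` cycles p K"
  by (auto simp: homology_def quotient_space_def A_RCOSETS_def' homology_class_def)

lemma self_in_homology_class: "z \<in> cycles p K \<Longrightarrow> z \<in> homology_class p K z"
  by (auto simp: homology_class_def a_r_coset_def' intro!: bexI[of _ 0])

lemma homology_class_eq_boundaries:
  assumes "z \<in> cycles p K"
  shows "homology_class p K z = boundaries p K \<longleftrightarrow> z \<in> boundaries p K"
  using assms self_in_homology_class[OF assms] Z.a_coset_join2[OF _ a_subgroup, of z]
  by (auto simp: homology_class_def)

text \<open>Every representative of \<open>A\<close> has class \<open>A\<close>, and
  \<open>A\<close> is nonempty, so the union defining the map is \<open>A\<close> itself.\<close>

lemma induced_map_self: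
  assumes "A \<in> carrier (homology p K)"
  shows "induced_map p K A = A"
proof -
  obtain z where z: "z \<in> cycles p K" "A = homology_class p K z"
    using assms by (auto simp: homology_carrier)
  have eq: "homology_class p K u = A" if "u \<in> A" for u
    using coset_eq[OF subspace_boundaries, of z u] that z by (simp add: homology_class_def)
  have "induced_map p K A = (\<Union>u\<in>A. A)"
    unfolding induced_map_def by (rule SUP_cong[OF refl eq])
  moreover have "A \<noteq> {}"
    using self_in_homology_class z by blast
  ultimately show ?thesis
    by simp
qed

lemma real_dim_homology_eq_1:
  assumes h: "h \<in> cycles p K" "h \<notin> boundaries p K"
    and gen: "\<And>z. z \<in> cycles p K \<Longrightarrow> \<exists>r. \<exists>w\<in>boundaries p K. z = w + r *\<^sub>R h"
  shows "real_dim (homology p K) = 1"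
  unfolding homology_def
  by (rule real_dim_quotient_space_eq_1[OF subspace_boundaries, of h]) (use assms in auto)

text \<open>The coset \<open>boundaries p K\<close> is the zero of homology, so its singleton is the
  zero subspace. This iterated quotient is the form that the persistence space of the infinite bar
  takes for the filtration below.\<close>

lemma real_dim_homology_mod_zero_eq_1:
  assumes h: "h \<in> cycles p K" "h \<notin> boundaries p K"
    and gen: "\<And>z. z \<in> cycles p K \<Longrightarrow> \<exists>r. \<exists>w\<in>boundaries p K. z = w + r *\<^sub>R h"
  shows "real_dim (quotient_space (homology p K) {boundaries p K}) = 1"
proof (rule real_dim_quotient_space_eq_1)
  show "subspace (class_ring :: real ring) {boundaries p K} (homology p K)"
    unfolding subspace_def LinearCombinations.submodule_def homology_zero[symmetric]
    using H.vectorspace_axioms H.module.module_axioms by auto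
  show "homology_class p K h \<in> carrier (homology p K)"
    using h by (simp add: homology_carrier)
  show "homology_class p K h \<notin> {boundaries p K}"
    using h by (simp add: homology_class_eq_boundaries)
  fix x assume x: "x \<in> carrier (homology p K)"
  then obtain z where z: "z \<in> cycles p K" "x = homology_class p K z"
    by (auto simp: homology_carrier)
  then obtain r w where rw: "w \<in> boundaries p K" "z = w + r *\<^sub>R h"
    using gen by blast
  have "z \<in> homology_class p K (r *\<^sub>R h)"
    using rw by (auto simp: homology_class_def a_r_coset_def')
  then have "x = homology_class p K (r *\<^sub>R h)"
    using coset_eq[OF subspace_boundaries, of "r *\<^sub>R h" z] h z
    by (simp add: homology_class_def cycles_scaleR)
  also have "\<dots> = r \<odot>\<^bsub>homology p K\<^esub> homology_class p K h"
    using quotient_space_smult[OF subspace_boundaries, of h r] h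
    by (simp add: homology_class_def homology_def)
  \<comment> \<open>Adding the zero class gives the shape \<open>w\<close> plus a multiple of the
    generator, with \<open>w\<close> in the zero subspace.\<close>
  also have "\<dots> = boundaries p K \<oplus>\<^bsub>homology p K\<^esub> (r \<odot>\<^bsub>homology p K\<^esub> homology_class p K h)"
    using H.l_zero[OF H.smult_closed[of r "homology_class p K h"]] h
    by (simp add: homology_zero homology_carrier)
  finally show "\<exists>r. \<exists>w\<in>{boundaries p K}. x = w \<oplus>\<^bsub>homology p K\<^esub> r \<odot>\<^bsub>homology p K\<^esub> homology_class p K h"
    by blast
qed

end

section \<open>The filtration from the empty complex to K\<close>

lemma cycles_empty: "cycles p {} = {0}"
  by (auto simp: cycles_def chain_space_def simplices_def)

lemma boundaries_empty: "boundaries p {} = {0}"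
  by (auto simp: boundaries_def chain_space_def simplices_def)

lemma harmonic_empty: "harmonic p {} = {0}"
  using zero_in_harmonic[of p "{}"] by (auto simp: harmonic_def cycles_empty)

lemma homology_empty: "carrier (homology p {}) = {{0}}"
  by (simp add: homology_def quotient_space_def A_RCOSETS_def' a_r_coset_def'
      cycles_empty boundaries_empty)

text \<open>The previous stage is empty and contributes only 0, while projection at the final stage
  fixes every harmonic chain.\<close>

lemma harmonic_M_two_stage: "harmonic_M p [{}, K] 1 1 = {0}"
  by (auto simp: harmonic_M_def prev_stage_def harmonic_empty harmonic_proj_harmonic)

lemma harmonic_P_two_stage: "harmonic_P p [{}, K] 1 \<infinity> = harmonic p K"
  by (auto simp: harmonic_P_def last_time_def harmonic_M_two_stage[simplified] orth_complement_def
      chain_inner_def)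

text \<open>The map into the homology of \<open>K\<close> is the identity on that homology, and the
  only class of the empty complex goes to the zero class, so only the zero class satisfies the
  membership condition.\<close>

lemma pers_M_two_stage:
  assumes "boundaries p K \<subseteq> cycles p K"
  shows "pers_M p [{}, K] 1 1 = {boundaries p K}"
proof -
  have "homology_class p K 0 = boundaries p K"
    using homology_class_eq_boundaries[OF assms] by simp
  moreover have "boundaries p K \<in> carrier (homology p K)"
    using calculation homology_carrier[OF assms] cycles_zero by (metis image_eqI)
  ultimately show ?thesis
    by (auto simp: pers_M_def prev_stage_def homology_empty induced_map_self[OF assms])
      (auto simp: induced_map_def)
qed

lemma pers_mult_two_stage:
  assumes "boundaries p K \<subseteq> cycles p K"
  shows "pers_mult p [{}, K] 1 \<infinity> = real_dim (quotient_space (homology p K) {boundaries p K})"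
  using pers_M_two_stage[OF assms] by (simp add: pers_mult_def pers_P_def last_time_def)

lemma bar_reps_two_stage:
  assumes "boundaries p K \<subseteq> cycles p K"
  shows "bar_reps p [{}, K] (1, \<infinity>, m) = cycles p K - boundaries p K"
  using pers_M_two_stage[OF assms] homology_class_eq_boundaries[OF assms]
  by (auto simp: last_time_def cycles_M_def)

text \<open>The possible deaths are 0, 1 and \<infinity>, and only \<infinity> comes after the birth
  time 1. Hence no competing bar exists and a simple bar is generic.\<close>

lemma bar_two_stage:
  assumes "pers_mult p [{}, K] 1 \<infinity> = 1"
  shows "(1, \<infinity>, 1) \<in> barcode p [{}, K]" "generic_bar p [{}, K] (1, \<infinity>, 1)"
  using assms by (auto simp: barcode_def birth_times_def death_times_def last_time_def)

section \<open>A projective plane with a tetrahedron attached\<close>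

lemma simplex_boundary_triangle:
  assumes "a < b" "b < c"
  shows "simplex_boundary {a, b, c} = basis_chain {b, c} - basis_chain {a, c} + basis_chain {a, b}"
proof -
  have l: "sorted_list_of_set {a, b, c} = [a, b, c]"
    using assms by simp
  have "card {a, b, c} = 3" "{a, b, c} - {a} = {b, c}" "{a, b, c} - {b} = {a, c}"
    "{a, b, c} - {c} = {a, b}"
    using assms by auto
  then show ?thesis
    unfolding simplex_boundary_def l by (simp add: numeral_3_eq_3)
qed

text \<open>The first ten triangles form the projective plane; the last four are the faces of the
  tetrahedron with base \<open>{0,1,2}\<close> and apex 6.\<close>

definition triangles :: "nat set set" where
  "triangles = {{0,1,3}, {0,1,4}, {0,2,4}, {0,2,5}, {0,3,5}, {1,2,3}, {1,2,5}, {1,4,5},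
     {2,3,4}, {3,4,5}, {0,1,2}, {0,1,6}, {0,2,6}, {1,2,6}}"

text \<open>Not only maximal faces: the four faces of the tetrahedron are kept as well, so that
  \<open>triangles\<close> is the full set of 2-simplices.\<close>

definition facets :: "nat set set" where
  "facets = insert {0,1,2,6} triangles"

definition J2 :: simplicial_complex where
  "J2 = {\<rho>. \<exists>\<sigma>\<in>facets. \<rho> \<subseteq> \<sigma>}"

text \<open>The boundary of the tetrahedron.\<close>

definition b2 :: chain where
  "b2 = basis_chain {1,2,6} - basis_chain {0,2,6} + basis_chain {0,1,6} - basis_chain {0,1,2}"

text \<open>This is \<open>z + b2\<close>, where the cycle \<open>z\<close> has coefficient 2 or -2
  on the projective plane, 4 on \<open>{0,1,2}\<close> and 0 on the triangles at the apex. The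
  multiple of \<open>b2\<close> is forced by orthogonality: \<open>z\<close> and \<open>b2\<close>
  have inner product -4, and \<open>b2\<close> has squared norm 4.\<close>

definition h2 :: chain where
  "h2 = 2 *\<^sub>R (basis_chain {0,2,4} + basis_chain {0,2,5} + basis_chain {1,4,5} + basis_chain {2,3,4})
     - 2 *\<^sub>R (basis_chain {0,1,3} + basis_chain {0,1,4} + basis_chain {0,3,5} + basis_chain {1,2,3}
            + basis_chain {1,2,5} + basis_chain {3,4,5})
     + 3 *\<^sub>R basis_chain {0,1,2} + basis_chain {0,1,6} - basis_chain {0,2,6} + basis_chain {1,2,6}"

lemma simplex_boundary_tetrahedron: "simplex_boundary {0,1,2,6} = b2"
proof -
  have l: "sorted_list_of_set {0,1,2,6} = [0,1,2,6::nat]"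
    by simp
  have "card {0,1,2,6::nat} = 4" "{0,1,2,6::nat} - {0} = {1,2,6}" "{0,1,2,6::nat} - {1} = {0,2,6}"
    "{0,1,2,6::nat} - {2} = {0,1,6}" "{0,1,2,6::nat} - {6} = {0,1,2}"
    by auto
  then show ?thesis
    unfolding simplex_boundary_def l by (simp add: eval_nat_numeral b2_def)
qed

lemma card_triangle: "\<sigma> \<in> triangles \<Longrightarrow> card \<sigma> = 3"
  by (auto simp: triangles_def)

lemma finite_triangle: "\<sigma> \<in> triangles \<Longrightarrow> finite \<sigma>"
  by (auto simp: triangles_def)

lemma finite_triangles: "finite triangles"
  by (simp add: triangles_def)

section \<open>Simplices and dimension of \<open>J2\<close>\<close>

lemma J2E:
  assumes "\<rho> \<in> J2"
  obtains "\<rho> \<subseteq> {0,1,2,6}" | \<sigma> where "\<sigma> \<in> triangles" "\<rho> \<subseteq> \<sigma>"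
  using assms unfolding J2_def facets_def by blast

lemma tetrahedron_in_J2: "{0,1,2,6} \<in> J2"
  unfolding J2_def facets_def by blast

lemma triangles_subset_J2: "triangles \<subseteq> J2"
  unfolding J2_def facets_def by blast

lemma simplices_3_J2: "simplices 3 J2 = {{0,1,2,6}}"
proof (intro equalityI subsetI)
  fix \<rho> assume "\<rho> \<in> simplices 3 J2"
  then have c: "card \<rho> = 4" and "\<rho> \<in> J2"
    by (simp_all add: simplices_def)
  from this(2) show "\<rho> \<in> {{0,1,2,6}}"
  proof (cases rule: J2E)
    case 1
    then have "\<rho> = {0,1,2,6}"
      by (intro card_subset_eq) (simp_all add: c)
    then show ?thesis
      by (rule ssubst) (rule singletonI)
  next
    case (2 \<sigma>)
    then show ?thesis
      using card_mono[OF finite_triangle, of \<sigma> \<rho>] card_triangle[of \<sigma>] c by simp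
  qed
next
  fix \<rho> :: "nat set" assume "\<rho> \<in> {{0,1,2,6}}"
  then have "\<rho> = {0,1,2,6}"
    by (rule singletonD)
  then show "\<rho> \<in> simplices 3 J2"
    using tetrahedron_in_J2 by (simp add: simplices_def del: One_nat_def)
qed

lemma simplices_2_J2: "simplices 2 J2 = triangles"
proof
  show "simplices 2 J2 \<subseteq> triangles"
  proof
    fix \<rho> assume "\<rho> \<in> simplices 2 J2"
    then have c: "card \<rho> = 3" "finite \<rho>" and "\<rho> \<in> J2"
      by (auto simp: simplices_def)
    from this(3) show "\<rho> \<in> triangles"
    proof (cases rule: J2E)
      case 1
      \<comment> \<open>A triangle inside the tetrahedron omits exactly one vertex \<open>x\<close>;
        the four choices of \<open>x\<close> give the four listed faces.\<close>
      then have "card ({0,1,2,6} - \<rho>) = 1"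
        using c by (subst card_Diff_subset) auto
      then obtain x where x: "{0,1,2,6} - \<rho> = {x}"
        by (rule card_1_singletonE)
      have \<rho>: "\<rho> = {0,1,2,6} - {x}"
        using 1 by (simp add: double_diff flip: x)
      have "x \<in> {0,1,2,6} - \<rho>"
        unfolding x by simp
      then have "x = 0 \<or> x = 1 \<or> x = 2 \<or> x = 6"
        by simp
      then show ?thesis
        unfolding \<rho> by (elim disjE) (simp_all add: triangles_def insert_Diff_if)
    next
      case (2 \<sigma>)
      then show ?thesis
        using card_subset_eq[of \<sigma> \<rho>] c card_triangle[of \<sigma>] finite_triangle[of \<sigma>] by auto
    qed
  qed
  show "triangles \<subseteq> simplices 2 J2"
    using card_triangle finite_triangle triangles_subset_J2 by (auto simp: simplices_def)
qed

lemma facet_subset: "\<sigma> \<in> facets \<Longrightarrow> \<sigma> \<subseteq> {0..6}"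
  by (auto simp: facets_def triangles_def)

lemma card_facet_le: "\<sigma> \<in> facets \<Longrightarrow> card \<sigma> \<le> 4"
  using card_triangle[of \<sigma>] by (auto simp: facets_def)

lemma finite_complex_J2: "finite_complex J2"
  unfolding finite_complex_def
proof
  show "\<exists>m. J2 \<subseteq> Pow {0..m}"
    using facet_subset by (fastforce simp: J2_def)
  show "\<forall>\<sigma>\<in>J2. \<forall>\<rho>. \<rho> \<subseteq> \<sigma> \<longrightarrow> \<rho> \<in> J2"
    by (auto simp: J2_def intro: order_trans)
qed

lemma complex_dim_J2: "complex_dim J2 = 3"
proof -
  have "finite J2"
    using finite_complex_J2 by (auto simp: finite_complex_def intro: finite_subset)
  moreover have "card \<rho> \<le> 4" if \<rho>: "\<rho> \<in> J2" for \<rho>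
  proof -
    obtain \<sigma> where \<sigma>: "\<sigma> \<in> facets" "\<rho> \<subseteq> \<sigma>"
      using \<rho> by (auto simp: J2_def)
    then have "card \<rho> \<le> card \<sigma>"
      using facet_subset by (intro card_mono finite_subset[of \<sigma> "{0..6}"]) auto
    then show ?thesis
      using card_facet_le[OF \<sigma>(1)] by simp
  qed
  moreover have "3 = int (card {0,1,2,6::nat}) - 1"
    by simp
  then have "3 \<in> (\<lambda>\<sigma>. int (card \<sigma>) - 1) ` J2"
    using tetrahedron_in_J2 by (rule image_eqI)
  ultimately show ?thesis
    using tetrahedron_in_J2 unfolding complex_dim_def by (subst Max_eqI[where x = 3]) force+
qed

section \<open>The 2-cycles and 2-boundaries of \<open>J2\<close>\<close>

lemma boundary_2_J2:
  assumes "supp c \<subseteq> triangles"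
  shows "boundary 2 c
     = Poly_Mapping.lookup c {0,1,3} *\<^sub>R (basis_chain {1,3} - basis_chain {0,3} + basis_chain {0,1})
     + Poly_Mapping.lookup c {0,1,4} *\<^sub>R (basis_chain {1,4} - basis_chain {0,4} + basis_chain {0,1})
     + Poly_Mapping.lookup c {0,2,4} *\<^sub>R (basis_chain {2,4} - basis_chain {0,4} + basis_chain {0,2})
     + Poly_Mapping.lookup c {0,2,5} *\<^sub>R (basis_chain {2,5} - basis_chain {0,5} + basis_chain {0,2})
     + Poly_Mapping.lookup c {0,3,5} *\<^sub>R (basis_chain {3,5} - basis_chain {0,5} + basis_chain {0,3})
     + Poly_Mapping.lookup c {1,2,3} *\<^sub>R (basis_chain {2,3} - basis_chain {1,3} + basis_chain {1,2})
     + Poly_Mapping.lookup c {1,2,5} *\<^sub>R (basis_chain {2,5} - basis_chain {1,5} + basis_chain {1,2})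
     + Poly_Mapping.lookup c {1,4,5} *\<^sub>R (basis_chain {4,5} - basis_chain {1,5} + basis_chain {1,4})
     + Poly_Mapping.lookup c {2,3,4} *\<^sub>R (basis_chain {3,4} - basis_chain {2,4} + basis_chain {2,3})
     + Poly_Mapping.lookup c {3,4,5} *\<^sub>R (basis_chain {4,5} - basis_chain {3,5} + basis_chain {3,4})
     + Poly_Mapping.lookup c {0,1,2} *\<^sub>R (basis_chain {1,2} - basis_chain {0,2} + basis_chain {0,1})
     + Poly_Mapping.lookup c {0,1,6} *\<^sub>R (basis_chain {1,6} - basis_chain {0,6} + basis_chain {0,1})
     + Poly_Mapping.lookup c {0,2,6} *\<^sub>R (basis_chain {2,6} - basis_chain {0,6} + basis_chain {0,2})
     + Poly_Mapping.lookup c {1,2,6} *\<^sub>R (basis_chain {2,6} - basis_chain {1,6} + basis_chain {1,2})"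
proof -
  have "boundary 2 c = (\<Sum>\<sigma>\<in>triangles. Poly_Mapping.lookup c \<sigma> *\<^sub>R simplex_boundary \<sigma>)"
    using assms by (intro boundary_eq_sum finite_triangles) simp_all
  then show ?thesis
    by (simp add: triangles_def set_eq_subset simplex_boundary_triangle del: One_nat_def)
qed

lemma lookup_h2:
  "Poly_Mapping.lookup h2 {0,1,3} = -2"
  "Poly_Mapping.lookup h2 {0,1,4} = -2"
  "Poly_Mapping.lookup h2 {0,2,4} = 2"
  "Poly_Mapping.lookup h2 {0,2,5} = 2"
  "Poly_Mapping.lookup h2 {0,3,5} = -2"
  "Poly_Mapping.lookup h2 {1,2,3} = -2"
  "Poly_Mapping.lookup h2 {1,2,5} = -2"
  "Poly_Mapping.lookup h2 {1,4,5} = 2"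
  "Poly_Mapping.lookup h2 {2,3,4} = 2"
  "Poly_Mapping.lookup h2 {3,4,5} = -2"
  "Poly_Mapping.lookup h2 {0,1,2} = 3"
  "Poly_Mapping.lookup h2 {0,1,6} = 1"
  "Poly_Mapping.lookup h2 {0,2,6} = -1"
  "Poly_Mapping.lookup h2 {1,2,6} = 1"
  by (simp_all add: h2_def lookup_add lookup_minus basis_chain_def lookup_single when_def set_eq_subset
      del: One_nat_def)

lemma lookup_b2:
  "Poly_Mapping.lookup b2 {0,1,3} = 0"
  "Poly_Mapping.lookup b2 {0,1,4} = 0"
  "Poly_Mapping.lookup b2 {0,2,4} = 0"
  "Poly_Mapping.lookup b2 {0,2,5} = 0"
  "Poly_Mapping.lookup b2 {0,3,5} = 0"
  "Poly_Mapping.lookup b2 {1,2,3} = 0"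
  "Poly_Mapping.lookup b2 {1,2,5} = 0"
  "Poly_Mapping.lookup b2 {1,4,5} = 0"
  "Poly_Mapping.lookup b2 {2,3,4} = 0"
  "Poly_Mapping.lookup b2 {3,4,5} = 0"
  "Poly_Mapping.lookup b2 {0,1,2} = -1"
  "Poly_Mapping.lookup b2 {0,1,6} = 1"
  "Poly_Mapping.lookup b2 {0,2,6} = -1"
  "Poly_Mapping.lookup b2 {1,2,6} = 1"
  by (simp_all add: b2_def lookup_add lookup_minus basis_chain_def lookup_single when_def
      set_eq_subset del: One_nat_def)

lemma supp_h2: "supp h2 \<subseteq> triangles"
proof -
  have "Poly_Mapping.lookup h2 \<sigma> = 0" if "\<forall>\<rho>\<in>triangles. \<rho> \<noteq> \<sigma>" for \<sigma>
    using that by (simp add: triangles_def h2_def lookup_add lookup_minus basis_chain_def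
        lookup_single del: One_nat_def)
  then show ?thesis
    by (metis in_keys_iff subsetI)
qed

lemma supp_b2: "supp b2 \<subseteq> triangles"
proof -
  have "Poly_Mapping.lookup b2 \<sigma> = 0" if "\<forall>\<rho>\<in>triangles. \<rho> \<noteq> \<sigma>" for \<sigma>
    using that by (simp add: triangles_def b2_def lookup_add lookup_minus basis_chain_def
        lookup_single del: One_nat_def)
  then show ?thesis
    by (metis in_keys_iff subsetI)
qed

lemma boundary_h2: "boundary 2 h2 = 0"
  by (rule poly_mapping_eqI)
    (simp add: boundary_2_J2[OF supp_h2] lookup_h2 lookup_add lookup_minus del: One_nat_def)

lemma boundary_b2: "boundary 2 b2 = 0"
  by (rule poly_mapping_eqI)
    (simp add: boundary_2_J2[OF supp_b2] lookup_b2 lookup_add lookup_minus del: One_nat_def)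

lemma h2_cycle: "h2 \<in> cycles 2 J2"
  using supp_h2 by (simp add: cycles_def chain_space_def simplices_2_J2 boundary_h2)

lemma b2_cycle: "b2 \<in> cycles 2 J2"
  using supp_b2 by (simp add: cycles_def chain_space_def simplices_2_J2 boundary_b2)

lemma lookup_basis_chain_edge:
  "Poly_Mapping.lookup (basis_chain {i, j}) {k, l} = (if i = k \<and> j = l \<or> i = l \<and> j = k then 1 else 0)"
  by (simp add: basis_chain_def lookup_single when_def doubleton_eq_iff)

text \<open>Each edge of the projective plane outside \<open>{0,1,2}\<close> lies in just two
  triangles, so its equation ties their coefficients up to sign; as these edges connect the ten
  triangles, one parameter remains there. The edges at 6 leave one parameter on the three triangles
  at the apex. An edge of \<open>{0,1,2}\<close> then fixes the coefficient of that
  triangle.\<close>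

lemma cycles_2_J2:
  assumes c: "c \<in> cycles 2 J2"
  obtains r s where "c = r *\<^sub>R h2 + s *\<^sub>R b2"
proof -
  have sub: "supp c \<subseteq> triangles"
    using supp_subset_simplices[OF c] by (simp add: simplices_2_J2)
  have "Poly_Mapping.lookup (boundary 2 c) e = 0" for e
    using c by (simp add: cycles_def)
  \<comment> \<open>Evaluated at an edge, the expanded boundary becomes one linear equation in the
    coefficients of \<open>c\<close>; there are eighteen edges.\<close>
  note bd = this[unfolded boundary_2_J2[OF sub] lookup_add lookup_minus lookup_scaleR]
  note simps = lookup_basis_chain_edge
  have e01: "Poly_Mapping.lookup c {0,1,3} + Poly_Mapping.lookup c {0,1,4} + Poly_Mapping.lookup c {0,1,2} + Poly_Mapping.lookup c {0,1,6} = 0"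
    using bd[of "{0,1}"] by (simp add: simps)
  have e02: "Poly_Mapping.lookup c {0,2,4} + Poly_Mapping.lookup c {0,2,5} - Poly_Mapping.lookup c {0,1,2} + Poly_Mapping.lookup c {0,2,6} = 0"
    using bd[of "{0,2}"] by (simp add: simps)
  have e03: "- Poly_Mapping.lookup c {0,1,3} + Poly_Mapping.lookup c {0,3,5} = 0"
    using bd[of "{0,3}"] by (simp add: simps)
  have e04: "- Poly_Mapping.lookup c {0,1,4} - Poly_Mapping.lookup c {0,2,4} = 0"
    using bd[of "{0,4}"] by (simp add: simps)
  have e05: "- Poly_Mapping.lookup c {0,2,5} - Poly_Mapping.lookup c {0,3,5} = 0"
    using bd[of "{0,5}"] by (simp add: simps)
  have e06: "- Poly_Mapping.lookup c {0,1,6} - Poly_Mapping.lookup c {0,2,6} = 0"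
    using bd[of "{0,6}"] by (simp add: simps)
  have e12: "Poly_Mapping.lookup c {1,2,3} + Poly_Mapping.lookup c {1,2,5} + Poly_Mapping.lookup c {0,1,2} + Poly_Mapping.lookup c {1,2,6} = 0"
    using bd[of "{1,2}"] by (simp add: simps)
  have e13: "Poly_Mapping.lookup c {0,1,3} - Poly_Mapping.lookup c {1,2,3} = 0"
    using bd[of "{1,3}"] by (simp add: simps)
  have e14: "Poly_Mapping.lookup c {0,1,4} + Poly_Mapping.lookup c {1,4,5} = 0"
    using bd[of "{1,4}"] by (simp add: simps)
  have e15: "- Poly_Mapping.lookup c {1,2,5} - Poly_Mapping.lookup c {1,4,5} = 0"
    using bd[of "{1,5}"] by (simp add: simps)
  have e16: "Poly_Mapping.lookup c {0,1,6} - Poly_Mapping.lookup c {1,2,6} = 0"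
    using bd[of "{1,6}"] by (simp add: simps)
  have e23: "Poly_Mapping.lookup c {1,2,3} + Poly_Mapping.lookup c {2,3,4} = 0"
    using bd[of "{2,3}"] by (simp add: simps)
  have e24: "Poly_Mapping.lookup c {0,2,4} - Poly_Mapping.lookup c {2,3,4} = 0"
    using bd[of "{2,4}"] by (simp add: simps)
  have e25: "Poly_Mapping.lookup c {0,2,5} + Poly_Mapping.lookup c {1,2,5} = 0"
    using bd[of "{2,5}"] by (simp add: simps)
  have e26: "Poly_Mapping.lookup c {0,2,6} + Poly_Mapping.lookup c {1,2,6} = 0"
    using bd[of "{2,6}"] by (simp add: simps)
  have e34: "Poly_Mapping.lookup c {2,3,4} + Poly_Mapping.lookup c {3,4,5} = 0"
    using bd[of "{3,4}"] by (simp add: simps)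
  have e35: "Poly_Mapping.lookup c {0,3,5} - Poly_Mapping.lookup c {3,4,5} = 0"
    using bd[of "{3,5}"] by (simp add: simps)
  have e45: "Poly_Mapping.lookup c {1,4,5} + Poly_Mapping.lookup c {3,4,5} = 0"
    using bd[of "{4,5}"] by (simp add: simps)
  \<comment> \<open>At \<open>{1,4,5}\<close> the chain \<open>h2\<close> has coefficient 2 and
    \<open>b2\<close> vanishes, which determines \<open>r\<close>.\<close>
  define r where "r = Poly_Mapping.lookup c {1,4,5} / 2"
  \<comment> \<open>At \<open>{0,1,6}\<close> both generators have coefficient 1, which determines
    \<open>s\<close>.\<close>
  define s where "s = Poly_Mapping.lookup c {0,1,6} - r"
  note eqs = e01 e02 e03 e04 e05 e06 e12 e13 e14 e15 e16 e23 e24 e25 e26 e34 e35 e45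
  have on_triangles: "\<forall>k\<in>triangles. Poly_Mapping.lookup c k
      = r * Poly_Mapping.lookup h2 k + s * Poly_Mapping.lookup b2 k"
    unfolding triangles_def ball_simps lookup_h2 lookup_b2
    using eqs r_def s_def by (intro conjI TrueI) linarith+
  have "c = r *\<^sub>R h2 + s *\<^sub>R b2"
  proof (rule poly_mapping_eqI)
    fix k
    show "Poly_Mapping.lookup c k = Poly_Mapping.lookup (r *\<^sub>R h2 + s *\<^sub>R b2) k"
    proof (cases "k \<in> triangles")
      case True
      then show ?thesis
        using on_triangles by (simp add: lookup_add)
    next
      case False
      then have "k \<notin> supp c" "k \<notin> supp h2" "k \<notin> supp b2"
        using sub supp_h2 supp_b2 by auto
      then show ?thesis
        by (simp add: lookup_add in_keys_iff)
    qed
  qed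
  then show thesis
    by (rule that)
qed

text \<open>The tetrahedron is the only 3-simplex, so a 3-chain is determined by one
  coefficient.\<close>

lemma boundaries_2_J2: "boundaries 2 J2 = range (\<lambda>s. s *\<^sub>R b2)"
proof -
  have bd: "boundary 3 x = Poly_Mapping.lookup x {0,1,2,6} *\<^sub>R b2" if "supp x \<subseteq> {{0,1,2,6}}" for x
    using boundary_eq_sum[OF _ that, of 3] by (simp add: simplex_boundary_tetrahedron del: One_nat_def)
  show ?thesis
  proof
    show "boundaries 2 J2 \<subseteq> range (\<lambda>s. s *\<^sub>R b2)"
      using bd by (auto simp: simplices_3_J2 elim!: boundariesE)
    have "s *\<^sub>R b2 \<in> boundaries 2 J2" for s
      using boundariesI[of "Poly_Mapping.single {0,1,2,6} s" 2 J2]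
        bd[of "Poly_Mapping.single {0,1,2,6} s"]
      by (simp add: simplices_3_J2 del: One_nat_def)
    then show "range (\<lambda>s. s *\<^sub>R b2) \<subseteq> boundaries 2 J2"
      by auto
  qed
qed

text \<open>The instance of \<partial>\<partial> = 0 assumed in the general results on homology; it
  follows from \<open>b2\<close> being a cycle.\<close>

lemma boundaries_2_J2_subset: "boundaries 2 J2 \<subseteq> cycles 2 J2"
  by (auto simp: boundaries_2_J2 intro: cycles_scaleR b2_cycle)

text \<open>The triangle \<open>{3,4,5}\<close> detects \<open>r\<close>: it lies off the
  tetrahedron, so \<open>b2\<close> vanishes there, while \<open>h2\<close> has coefficient
  -2.\<close>

lemma h2_combination_in_boundaries_iff:
  "r *\<^sub>R h2 + s *\<^sub>R b2 \<in> boundaries 2 J2 \<longleftrightarrow> r = 0"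
proof
  assume "r *\<^sub>R h2 + s *\<^sub>R b2 \<in> boundaries 2 J2"
  then obtain t where "r *\<^sub>R h2 + s *\<^sub>R b2 = t *\<^sub>R b2"
    by (auto simp: boundaries_2_J2)
  then have "Poly_Mapping.lookup (r *\<^sub>R h2 + s *\<^sub>R b2) {3,4,5} = Poly_Mapping.lookup (t *\<^sub>R b2) {3,4,5}"
    by simp
  then show "r = 0"
    by (simp add: lookup_add lookup_h2 lookup_b2)
qed (auto simp: boundaries_2_J2)

text \<open>The inner product with \<open>b2\<close> is -3 from \<open>{0,1,2}\<close> plus 1 from
  each of the three triangles at the apex.\<close>

lemma h2_harmonic: "h2 \<in> harmonic 2 J2"
proof -
  have "chain_inner h2 (s *\<^sub>R b2) = 0" for s
    unfolding chain_inner_eq_sum[OF finite_triangles supp_h2] triangles_def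
    by (simp add: set_eq_subset lookup_h2 lookup_b2 del: One_nat_def)
  then show ?thesis
    using h2_cycle by (auto simp: harmonic_def orth_complement_def boundaries_2_J2)
qed


section \<open>Generator of the homology, and essential simplices of the bar\<close>

lemma J2_homology_generated_by_h2:
  assumes "z \<in> cycles 2 J2"
  shows "\<exists>r. \<exists>w\<in>boundaries 2 J2. z = w + r *\<^sub>R h2"
proof -
  obtain r s where "z = r *\<^sub>R h2 + s *\<^sub>R b2"
    using assms by (rule cycles_2_J2)
  then show ?thesis
    by (auto simp: boundaries_2_J2 add.commute)
qed

text \<open>The representatives are the chains \<open>r *\<^sub>R h2 + s *\<^sub>R b2\<close> with
  \<open>r\<close> nonzero. The coefficient on \<open>{3,4,5}\<close> is \<open>-2 * r\<close> and
  never vanishes, whereas on \<open>{0,1,2}\<close> it is \<open>3 * r - s\<close>.\<close>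

lemma essential_simplices_J2:
  assumes "b = (1, \<infinity>, 1)"
  shows "{3,4,5} \<in> essential_simplices 2 [{}, J2] b"
    and "{0,1,2} \<notin> essential_simplices 2 [{}, J2] b"
proof -
  have reps: "bar_reps 2 [{}, J2] b = cycles 2 J2 - boundaries 2 J2"
    unfolding assms by (rule bar_reps_two_stage[OF boundaries_2_J2_subset])
  have "{3,4,5} \<in> supp z" if z: "z \<in> cycles 2 J2 - boundaries 2 J2" for z
  proof -
    obtain r s where "z = r *\<^sub>R h2 + s *\<^sub>R b2"
      using z cycles_2_J2 by blast
    moreover from this have "r \<noteq> 0"
      using z h2_combination_in_boundaries_iff[of r s] by auto
    ultimately show ?thesis
      by (simp add: in_keys_iff lookup_add lookup_h2 lookup_b2)
  qed
  then show "{3,4,5} \<in> essential_simplices 2 [{}, J2] b"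
    by (simp add: essential_simplices_def reps)
  \<comment> \<open>The choice \<open>r = 1\<close>, \<open>s = 3\<close> cancels the coefficient on
    \<open>{0,1,2}\<close>, moving the cycle onto the other faces of the tetrahedron.\<close>
  let ?z = "1 *\<^sub>R h2 + 3 *\<^sub>R b2"
  have "?z \<in> bar_reps 2 [{}, J2] b"
    unfolding reps Diff_iff h2_combination_in_boundaries_iff
    by (intro conjI cycles_add cycles_scaleR h2_cycle b2_cycle) simp
  moreover have "{0,1,2} \<notin> supp ?z"
    by (simp add: in_keys_iff lookup_add lookup_h2 lookup_b2 del: One_nat_def)
  ultimately show "{0,1,2} \<notin> essential_simplices 2 [{}, J2] b"
    unfolding essential_simplices_def by blast
qed

theorem theorem3:
  shows "\<exists>J :: simplicial_complex.
    finite_complex J \<and> complex_dim J = 3 \<and>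
    real_dim (homology 2 J) = 1 \<and>
    is_filtration [{}, J] \<and>
    (\<exists>(b :: bar) (h :: chain) \<sigma> \<tau>.
       b = (1, \<infinity>, 1) \<and> b \<in> barcode 2 [{}, J] \<and> generic_bar 2 [{}, J] b \<and>
       harmonic_rep 2 [{}, J] b h \<and>
       \<sigma> \<in> essential_simplices 2 [{}, J] b \<and>
       \<tau> \<in> simplices 2 J - essential_simplices 2 [{}, J] b \<and>
       \<bar>chain_inner h (basis_chain \<sigma>)\<bar> < \<bar>chain_inner h (basis_chain \<tau>)\<bar>)"
proof -
  define b :: bar where "b = (1, \<infinity>, 1)"
  have h2: "h2 \<notin> boundaries 2 J2"
    using h2_combination_in_boundaries_iff[of 1 0] by simp
  have "pers_mult 2 [{}, J2] 1 \<infinity> = 1"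
    unfolding pers_mult_two_stage[OF boundaries_2_J2_subset]
    by (rule real_dim_homology_mod_zero_eq_1[OF boundaries_2_J2_subset h2_cycle h2
          J2_homology_generated_by_h2])
  note bar = bar_two_stage[OF this, folded b_def]
  have "harmonic_rep 2 [{}, J2] b h2"
    using bar(2) h2_harmonic h2 boundaries_zero[of 2 J2]
    by (auto simp: b_def harmonic_P_two_stage[simplified])
  moreover have "real_dim (homology 2 J2) = 1"
    by (rule real_dim_homology_eq_1[OF boundaries_2_J2_subset h2_cycle h2
          J2_homology_generated_by_h2])
  moreover have "is_filtration [{}, J2]"
    using finite_complex_J2 by (simp add: is_filtration_def finite_complex_def)
  moreover have "{0,1,2} \<in> simplices 2 J2 - essential_simplices 2 [{}, J2] b"
    using essential_simplices_J2(2)[OF b_def] unfolding simplices_2_J2 by (simp add: triangles_def)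
  \<comment> \<open>The two absolute values are 2 on the essential triangle and 3 on the inessential
    one.\<close>
  moreover have "\<bar>chain_inner h2 (basis_chain {3,4,5})\<bar> < \<bar>chain_inner h2 (basis_chain {0,1,2})\<bar>"
    by (simp add: chain_inner_basis_chain lookup_h2 del: One_nat_def)
  ultimately show ?thesis
    using finite_complex_J2 complex_dim_J2 essential_simplices_J2(1)[OF b_def] bar b_def by blast
qed

end
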